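(* Let $G$ be a finite simple graph with boundary $\delta\Omega\subseteq V(G)$, and let $\xi,\ell\ge 1$ be integers. Suppose a finite simple graph $H$ contains $G$ as a $(\xi,\ell)$-immersion, and regard $\delta\Omega$ as a subset of $V(H)$ via the vertex map of this immersion. Then for every $k=1,\dots,|\delta\Omega|$, $$\lambda_k(G,\delta\Omega)\le \xi\,\ell\,\lambda_k(H,\delta\Omega).$$
   Context: A graph $H$ contains $G$ as a $(\xi,\ell)$-immersion if there is an injective map $\pi:V(G)\to V(H)$ and, for each edge $\{x,y\}\in E(G)$, a path $P_{xy}$ in $H$ of length at most $\ell$ joining $\pi(x)$ and $\pi(y)$, such that each edge of $H$ lies in at most $\xi$ of these paths; the boundary $\delta\Omega$ is then identified with $\pi(\delta\Omega)\subseteq V(H)$. For a graph $G=(V,E)$ with boundary $\delta\Omega\subseteq V$ (nonempty), the Steklov eigenvalues are $\lambda_k(G,\delta\Omega)=\min_{W\subseteq\mathbb{R}^V,\ \dim W=k}\max_{f\in W}\frac{\sum_{\{x,y\}\in E}(f(x)-f(y))^2}{\sum_{x\in\delta\Omega}f(x)^2}$, $k=1,\dots,|\delta\Omega|$ (equivalently the eigenvalues $\lambda$ of the problem: $\sum_{y\sim x}(f(x)-f(y))=0$ for $x\notin\delta\Omega$, $\sum_{y\sim x}(f(x)-f(y))=\lambda f(x)$ for $x\in\delta\Omega$). *)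

theory Defs
  imports "HOL-Analysis.Analysis"
begin

text \<open>
  A finite graph has a finite type \<open>'v\<close> as its vertex set and is given by its set of edges,
  the edge joining \<open>x\<close> and \<open>y\<close> being the unordered pair \<open>{x, y}\<close>.
\<close>

definition simple_graph :: "'v::finite set set \<Rightarrow> bool" where
  "simple_graph E \<longleftrightarrow> (\<forall>e\<in>E. card e = 2)"

text \<open>
  A path is the list of its vertices, without repetitions; its length is the number of edges,
  i.e. one less than the length of the list.
\<close>

definition path_edges :: "'v list \<Rightarrow> 'v set set" where
  "path_edges p = {{p ! i, p ! Suc i} | i. Suc i < length p}"

definition graph_path :: "'v::finite set set \<Rightarrow> 'v list \<Rightarrow> bool" where
  "graph_path E p \<longleftrightarrow> p \<noteq> [] \<and> distinct p \<and> path_edges p \<subseteq> E"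

definition path_length :: "'v list \<Rightarrow> nat" where
  "path_length p = length p - 1"

text \<open>
  The path \<open>P {x, y}\<close> is indexed by the unordered edge, hence may be traversed in either direction.
\<close>

definition immersion ::
  "nat \<Rightarrow> nat \<Rightarrow> 'v::finite set set \<Rightarrow> 'w::finite set set \<Rightarrow> ('v \<Rightarrow> 'w) \<Rightarrow> bool" where
  "immersion \<xi> l G H \<pi> \<longleftrightarrow>
     inj \<pi> \<and>
     (\<exists>P :: 'v set \<Rightarrow> 'w list.
        (\<forall>x y. {x, y} \<in> G \<longrightarrow>
           graph_path H (P {x, y}) \<and> path_length (P {x, y}) \<le> l \<and>
           {hd (P {x, y}), last (P {x, y})} = {\<pi> x, \<pi> y}) \<and>
        (\<forall>e\<in>H. card {d \<in> G. e \<in> path_edges (P d)} \<le> \<xi>))"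

definition edge_sq_diff :: "real ^ 'v::finite \<Rightarrow> 'v set \<Rightarrow> real" where
  "edge_sq_diff f e = (THE d. \<exists>x y. e = {x, y} \<and> d = (f $ x - f $ y)\<^sup>2)"

lemma edge_sq_diff_doubleton [simp]: "edge_sq_diff f {x, y} = (f $ x - f $ y)\<^sup>2"
  unfolding edge_sq_diff_def
  by (rule the_equality) (auto simp: doubleton_eq_iff power2_commute)

definition dirichlet_energy :: "'v::finite set set \<Rightarrow> real ^ 'v \<Rightarrow> real" where
  "dirichlet_energy E f = (\<Sum>e\<in>E. edge_sq_diff f e)"

text \<open>
  The quotient is \<open>\<infinity>\<close> for every function vanishing on the boundary, also when the energy is zero.
  The latter case occurs if some component contains no boundary vertex; disregarding
  \<open>0 / 0\<close> would let such components contribute spurious zero eigenvalues.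
\<close>

definition steklov_quotient :: "'v::finite set set \<Rightarrow> 'v set \<Rightarrow> real ^ 'v \<Rightarrow> ereal" where
  "steklov_quotient E B f =
     (if (\<Sum>x\<in>B. (f $ x)\<^sup>2) = 0 then \<infinity>
      else ereal (dirichlet_energy E f / (\<Sum>x\<in>B. (f $ x)\<^sup>2)))"

definition steklov_eigenvalue :: "'v::finite set set \<Rightarrow> 'v set \<Rightarrow> nat \<Rightarrow> ereal" where
  "steklov_eigenvalue E B k =
     (INF W \<in> {W :: (real ^ 'v) set. subspace W \<and> dim W = k}.
        SUP f \<in> W - {0}. steklov_quotient E B f)"

lemma simple_graph_edgeE:
  assumes "simple_graph E" "e \<in> E"
  obtains x y where "x \<noteq> y" "e = {x, y}"
  using assms unfolding simple_graph_def by (metis card_2_iff)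

text \<open>In the relevant range of indices the eigenvalues are finite.\<close>

lemma steklov_eigenvalue_finite:
  fixes E :: "'v::finite set set"
  assumes E: "simple_graph E" and k: "1 \<le> k" "k \<le> card B"
  shows "0 \<le> steklov_eigenvalue E B k" and "steklov_eigenvalue E B k < \<infinity>"
proof -
  have sq_nonneg: "0 \<le> edge_sq_diff f e" if "e \<in> E" for f e
    using simple_graph_edgeE[OF E that] by (metis edge_sq_diff_doubleton zero_le_power2)
  have q_nonneg: "0 \<le> steklov_quotient E B f" for f
    unfolding steklov_quotient_def dirichlet_energy_def
    by (auto intro!: divide_nonneg_nonneg sum_nonneg sq_nonneg)
  show "0 \<le> steklov_eigenvalue E B k"
    unfolding steklov_eigenvalue_def
  proof (rule INF_greatest)
    fix W :: "(real ^ 'v) set"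
    assume W: "W \<in> {W. subspace W \<and> dim W = k}"
    have "\<not> W \<subseteq> {0}"
      using W k(1) dim_eq_0[of W] by auto
    then obtain f where "f \<in> W - {0}" by auto
    then show "0 \<le> (SUP f \<in> W - {0}. steklov_quotient E B f)"
      using q_nonneg by (meson SUP_upper2)
  qed
  obtain A where A: "A \<subseteq> B" "card A = k"
    using k(2) by (meson obtain_subset_with_card_n)
  define W where "W = {f :: real ^ 'v. \<forall>x. x \<notin> A \<longrightarrow> f $ x = 0}"
  have sub: "subspace W"
    by (auto simp: W_def subspace_def)
  have dimW: "dim W = k"
  proof -
    have "W = {f. \<forall>i\<in>Basis. i \<notin> (\<lambda>x. axis x 1) ` A \<longrightarrow> f \<bullet> i = 0}"
      by (auto simp: W_def Basis_vec_def inner_axis axis_eq_axis)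
    moreover have "dim {f :: real ^ 'v. \<forall>i\<in>Basis. i \<notin> (\<lambda>x. axis x 1) ` A \<longrightarrow> f \<bullet> i = 0}
        = card ((\<lambda>x. axis x 1 :: real ^ 'v) ` A)"
      by (rule dim_substandard) (auto simp: Basis_vec_def)
    moreover have "inj_on (\<lambda>x. axis x 1 :: real ^ 'v) A"
      by (auto simp: inj_on_def axis_eq_axis)
    ultimately show ?thesis using A by (simp add: card_image)
  qed
  have bound: "steklov_quotient E B f \<le> ereal (4 * card E)" if f: "f \<in> W - {0}" for f
  proof -
    let ?S = "\<Sum>x\<in>B. (f $ x)\<^sup>2"
    have le: "(f $ x)\<^sup>2 \<le> ?S" for x
    proof (cases "x \<in> B")
      case True then show ?thesis by (intro member_le_sum) auto
    next
      case False
      then have "f $ x = 0" using f A by (auto simp: W_def)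
      then show ?thesis by (simp add: sum_nonneg)
    qed
    obtain x where "f $ x \<noteq> 0" using f by (auto simp: vec_eq_iff)
    then have pos: "0 < ?S" using le[of x] by (smt (verit) zero_less_power2)
    have "dirichlet_energy E f \<le> (\<Sum>e\<in>E. 4 * ?S)"
      unfolding dirichlet_energy_def
    proof (rule sum_mono)
      fix e assume "e \<in> E"
      then obtain x y where "e = {x, y}" using simple_graph_edgeE[OF E] by metis
      moreover have "(f $ x - f $ y)\<^sup>2 \<le> 2 * (f $ x)\<^sup>2 + 2 * (f $ y)\<^sup>2"
        using zero_le_power2[of "f $ x + f $ y"] by (simp add: power2_sum power2_diff)
      ultimately show "edge_sq_diff f e \<le> 4 * ?S" using le[of x] le[of y] by simp
    qed
    then show ?thesis using pos
      by (simp add: steklov_quotient_def divide_le_eq mult_ac)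
  qed
  have "steklov_eigenvalue E B k \<le> (SUP f \<in> W - {0}. steklov_quotient E B f)"
    unfolding steklov_eigenvalue_def by (rule INF_lower) (simp add: sub dimW)
  also have "\<dots> \<le> ereal (4 * card E)" by (rule SUP_least) (rule bound)
  finally show "steklov_eigenvalue E B k < \<infinity>" by auto
qed

end

theory Submission
  imports Defs
begin

text \<open>
  Pull functions back along \<open>\<pi>\<close>. By Cauchy--Schwarz along the path replacing an edge of \<open>G\<close>, the
  squared difference across that edge is at most \<open>l\<close> times the energy of the path; summing over
  the edges of \<open>G\<close> counts every edge of \<open>H\<close> at most \<open>\<xi>\<close> times. Boundary sums are unchanged, and
  the pullback is injective on every test space with finite maximal quotient, since there no nonzero
  function vanishes on the boundary; hence it maps test spaces for \<open>H\<close> to test spaces for \<open>G\<close> of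
  the same dimension.
\<close>

lemma edge_sq_diff_nonneg:
  assumes "simple_graph E" "e \<in> E"
  shows "0 \<le> edge_sq_diff f e"
  using simple_graph_edgeE[OF assms] by (metis edge_sq_diff_doubleton zero_le_power2)

text \<open>If two steps give the same unordered pair, their ends match either in order, so the
  indices agree, or crosswise, which would make each index the successor of the other. Sums over the
  edge set of a path thus become sums over indices.\<close>

lemma inj_on_nth_edge:
  assumes "distinct p"
  shows "inj_on (\<lambda>i. {p ! i, p ! Suc i}) {..<length p - 1}"
proof (rule inj_onI)
  fix i j assume ij: "i \<in> {..<length p - 1}" "j \<in> {..<length p - 1}"
    and "{p ! i, p ! Suc i} = {p ! j, p ! Suc j}"
  then consider "p ! i = p ! j" | "p ! i = p ! Suc j" "p ! Suc i = p ! j"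
    by (auto simp: doubleton_eq_iff)
  then show "i = j"
  proof cases
    case 1
    then show ?thesis using ij assms by (simp add: nth_eq_iff_index_eq)
  next
    case 2
    then have "i = Suc j" "Suc i = j" using ij assms by (auto simp: nth_eq_iff_index_eq)
    then show ?thesis by simp
  qed
qed

lemma sum_path_edges:
  assumes "distinct p"
  shows "(\<Sum>e\<in>path_edges p. g e) = (\<Sum>i<length p - 1. g {p ! i, p ! Suc i})"
proof -
  have "path_edges p = (\<lambda>i. {p ! i, p ! Suc i}) ` {..<length p - 1}"
    by (auto simp: path_edges_def)
  then show ?thesis using sum.reindex[OF inj_on_nth_edge[OF assms], of g] by simp
qed

lemma sq_diff_endpoints_le:
  fixes f :: "real ^ 'v::finite"
  assumes "p \<noteq> []" "distinct p"
  shows "(f $ hd p - f $ last p)\<^sup>2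
           \<le> real (path_length p) * (\<Sum>e\<in>path_edges p. edge_sq_diff f e)"
proof -
  let ?n = "length p - 1"
  have "f $ last p - f $ hd p = (\<Sum>i<?n. f $ (p ! Suc i) - f $ (p ! i))"
    using assms(1)
    by (simp add: sum_lessThan_telescope[of "\<lambda>i. f $ (p ! i)"] hd_conv_nth last_conv_nth)
  then have "(f $ hd p - f $ last p)\<^sup>2 = (\<Sum>i<?n. f $ (p ! Suc i) - f $ (p ! i))\<^sup>2"
    by (metis power2_commute)
  \<comment> \<open>Cauchy-Schwarz against the constant 1 yields the number of edges of the path as
    factor.\<close>
  also have "\<dots> \<le> (\<Sum>i<?n. (f $ (p ! Suc i) - f $ (p ! i))\<^sup>2) * real (card {..<?n})"
    by (rule sum_squared_le_sum_of_squares)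
  also have "\<dots> = real ?n * (\<Sum>e\<in>path_edges p. edge_sq_diff f e)"
    by (simp add: sum_path_edges[OF assms(2)] power2_commute mult.commute)
  finally show ?thesis by (simp add: path_length_def)
qed

definition pullback :: "('v \<Rightarrow> 'w) \<Rightarrow> real ^ 'w::finite \<Rightarrow> real ^ 'v::finite" where
  "pullback \<pi> f = (\<chi> x. f $ \<pi> x)"

lemma pullback_nth [simp]: "pullback \<pi> f $ x = f $ \<pi> x"
  by (simp add: pullback_def)

lemma linear_pullback: "linear (pullback \<pi>)"
  by (rule linearI) (simp_all add: vec_eq_iff)

lemma dirichlet_energy_pullback_le:
  fixes G :: "'v::finite set set" and H :: "'w::finite set set"
  assumes G: "simple_graph G" and H: "simple_graph H" and imm: "immersion \<xi> l G H \<pi>"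
  shows "dirichlet_energy G (pullback \<pi> f) \<le> real \<xi> * real l * dirichlet_energy H f"
proof -
  obtain P :: "'v set \<Rightarrow> 'w list" where P:
    "\<And>x y. {x, y} \<in> G \<Longrightarrow> graph_path H (P {x, y}) \<and> path_length (P {x, y}) \<le> l \<and>
       {hd (P {x, y}), last (P {x, y})} = {\<pi> x, \<pi> y}"
    and cong: "\<And>e. e \<in> H \<Longrightarrow> card {d \<in> G. e \<in> path_edges (P d)} \<le> \<xi>"
    using imm unfolding immersion_def by blast
  \<comment> \<open>Summing over the edges of \<open>H\<close> filtered by membership in the path
    prepares the exchange of the two sums below.\<close>
  have edge: "edge_sq_diff (pullback \<pi> f) d
      \<le> real l * (\<Sum>e | e \<in> H \<and> e \<in> path_edges (P d). edge_sq_diff f e)"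
    if "d \<in> G" for d
  proof -
    obtain x y where d: "d = {x, y}" using simple_graph_edgeE[OF G \<open>d \<in> G\<close>] by metis
    have p: "graph_path H (P d)" "path_length (P d) \<le> l" "{hd (P d), last (P d)} = {\<pi> x, \<pi> y}"
      using P[of x y] that by (auto simp: d)
    have sub: "{e. e \<in> H \<and> e \<in> path_edges (P d)} = path_edges (P d)"
      using p(1) by (auto simp: graph_path_def)
    \<comment> \<open>The pair \<open>{\<pi> x, \<pi> y}\<close> may fail to be an edge of
      \<open>H\<close>. Its squared difference ignores order, so the direction in which
      \<open>P d\<close> is traversed is irrelevant.\<close>
    have "edge_sq_diff (pullback \<pi> f) d = edge_sq_diff f {\<pi> x, \<pi> y}"
      by (simp add: d)
    also have "\<dots> = (f $ hd (P d) - f $ last (P d))\<^sup>2"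
      by (simp flip: p(3))
    also have "\<dots> \<le> real (path_length (P d)) * (\<Sum>e\<in>path_edges (P d). edge_sq_diff f e)"
      using p(1) by (intro sq_diff_endpoints_le) (auto simp: graph_path_def)
    also have "\<dots> \<le> real l * (\<Sum>e\<in>path_edges (P d). edge_sq_diff f e)"
      using p(1,2) by (intro mult_right_mono sum_nonneg edge_sq_diff_nonneg[OF H])
        (auto simp: graph_path_def)
    finally show ?thesis by (simp add: sub)
  qed
  have "dirichlet_energy G (pullback \<pi> f)
      \<le> (\<Sum>d\<in>G. real l * (\<Sum>e | e \<in> H \<and> e \<in> path_edges (P d). edge_sq_diff f e))"
    unfolding dirichlet_energy_def by (rule sum_mono) (rule edge)
  \<comment> \<open>Double counting: after the exchange each edge of \<open>H\<close> is weighted by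
    the number of paths through it.\<close>
  also have "\<dots> = real l * (\<Sum>e\<in>H. \<Sum>d | d \<in> G \<and> e \<in> path_edges (P d). edge_sq_diff f e)"
    unfolding sum_distrib_left[symmetric] by (subst sum.swap_restrict) auto
  also have "\<dots> = real l * (\<Sum>e\<in>H. real (card {d \<in> G. e \<in> path_edges (P d)}) * edge_sq_diff f e)"
    by simp
  also have "\<dots> \<le> real l * (\<Sum>e\<in>H. real \<xi> * edge_sq_diff f e)"
    by (intro mult_left_mono sum_mono mult_right_mono edge_sq_diff_nonneg[OF H])
      (auto simp: cong)
  also have "\<dots> = real \<xi> * real l * dirichlet_energy H f"
    by (simp add: dirichlet_energy_def sum_distrib_left mult_ac)
  finally show ?thesis .
qed

lemma steklov_quotient_pullback_le:
  fixes G :: "'v::finite set set" and H :: "'w::finite set set"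
  assumes "simple_graph G" "simple_graph H" "immersion \<xi> l G H \<pi>" "1 \<le> \<xi>" "1 \<le> l"
  shows "steklov_quotient G B (pullback \<pi> f)
           \<le> ereal (real \<xi> * real l) * steklov_quotient H (\<pi> ` B) f"
proof -
  have inj: "inj_on \<pi> B"
    using assms(3) by (auto simp: immersion_def intro: inj_on_subset)
  have bdry: "(\<Sum>y\<in>\<pi> ` B. (f $ y)\<^sup>2) = (\<Sum>x\<in>B. (f $ \<pi> x)\<^sup>2)"
    by (simp add: sum.reindex[OF inj])
  have "dirichlet_energy G (pullback \<pi> f) / (\<Sum>x\<in>B. (f $ \<pi> x)\<^sup>2)
      \<le> real \<xi> * real l * dirichlet_energy H f / (\<Sum>x\<in>B. (f $ \<pi> x)\<^sup>2)"
    by (intro divide_right_mono dirichlet_energy_pullback_le[OF assms(1-3)] sum_nonneg) simp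
  \<comment> \<open>If the boundary sum vanishes, both quotients are \<open>\<infinity>\<close>, and
    the positive factor keeps the right side infinite.\<close>
  then show ?thesis
    using assms(4,5) by (simp add: steklov_quotient_def bdry)
qed

text \<open>The image of \<open>W\<close> under the pullback competes in the infimum for
  \<open>G\<close>. Fixing one \<open>W\<close> allows a case distinction on whether its supremum is
  infinite, where the bound is trivial.\<close>

lemma steklov_eigenvalue_le_SUP:
  fixes G :: "'v::finite set set" and H :: "'w::finite set set"
  assumes "simple_graph G" "simple_graph H" "immersion \<xi> l G H \<pi>" "1 \<le> \<xi>" "1 \<le> l"
    and W: "subspace W" "dim W = k"
  shows "steklov_eigenvalue G B k
           \<le> ereal (real \<xi> * real l) * (SUP f \<in> W - {0}. steklov_quotient H (\<pi> ` B) f)"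
    (is "_ \<le> ?c * ?M")
proof (cases "?M = \<infinity>")
  case True
  then show ?thesis using assms(4,5) by simp
next
  case False
  \<comment> \<open>A nonzero function in \<open>W\<close> vanishing on the boundary would have
    quotient \<open>\<infinity>\<close> and force \<open>?M = \<infinity>\<close>.\<close>
  have bdry: "(\<Sum>y\<in>\<pi> ` B. (f $ y)\<^sup>2) \<noteq> 0" if "f \<in> W - {0}" for f
    using False SUP_upper[OF that, of "steklov_quotient H (\<pi> ` B)"]
    by (auto simp: steklov_quotient_def)
  have ker: "f = 0" if "f \<in> W" "pullback \<pi> f = 0" for f
  proof (rule ccontr)
    assume "f \<noteq> 0"
    moreover have "\<forall>y\<in>\<pi> ` B. (f $ y)\<^sup>2 = 0"
      using that(2) by (auto simp: vec_eq_iff)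
    ultimately show False using bdry[of f] that(1) by (auto intro: sum.neutral)
  qed
  have "inj_on (pullback \<pi>) (span W)"
    unfolding span_eq_iff[THEN iffD2, OF W(1)]
    using ker by (simp add: linear_injective_on_subspace_0[OF linear_pullback W(1)])
  then have "dim (pullback \<pi> ` W) = k"
    using dim_image_eq[OF linear_pullback] W(2) by blast
  moreover have "subspace (pullback \<pi> ` W)"
    by (rule linear_subspace_image[OF linear_pullback W(1)])
  ultimately have "steklov_eigenvalue G B k
      \<le> (SUP g \<in> pullback \<pi> ` W - {0}. steklov_quotient G B g)"
    unfolding steklov_eigenvalue_def by (intro INF_lower) simp
  also have "\<dots> \<le> ?c * ?M"
  proof (rule SUP_least)
    fix g assume "g \<in> pullback \<pi> ` W - {0}"
    then obtain f where f: "f \<in> W - {0}" "g = pullback \<pi> f"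
      using linear_0[OF linear_pullback] by auto
    have "steklov_quotient G B g \<le> ?c * steklov_quotient H (\<pi> ` B) f"
      unfolding f(2) by (rule steklov_quotient_pullback_le[OF assms(1-5)])
    also have "\<dots> \<le> ?c * ?M"
      by (intro ereal_mult_left_mono SUP_upper f(1)) simp
    finally show "steklov_quotient G B g \<le> ?c * ?M" .
  qed
  finally show ?thesis .
qed

theorem theorem2p4:
  fixes G :: "'v::finite set set" and H :: "'w::finite set set"
    and B :: "'v set" and \<pi> :: "'v \<Rightarrow> 'w" and \<xi> l k :: nat
  assumes "simple_graph G" and "simple_graph H"
    and "B \<noteq> {}"
    and "1 \<le> \<xi>" and "1 \<le> l"
    and "immersion \<xi> l G H \<pi>"
    and "1 \<le> k" and "k \<le> card B"
  shows "steklov_eigenvalue G B k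
           \<le> ereal (real \<xi> * real l) * steklov_eigenvalue H (\<pi> ` B) k"
proof -
  let ?c = "ereal (real \<xi> * real l)"
  have c: "0 < ?c" "?c \<noteq> \<infinity>" using assms(4,5) by auto
  \<comment> \<open>Dividing by the positive finite constant leaves a bare infimum on the right, so
    a lower bound for each test space suffices.\<close>
  have "steklov_eigenvalue G B k / ?c \<le> steklov_eigenvalue H (\<pi> ` B) k"
    unfolding steklov_eigenvalue_def[of H]
  proof (rule INF_greatest)
    fix W :: "(real ^ 'w) set"
    assume "W \<in> {W. subspace W \<and> dim W = k}"
    then show "steklov_eigenvalue G B k / ?c \<le> (SUP f \<in> W - {0}. steklov_quotient H (\<pi> ` B) f)"
      using steklov_eigenvalue_le_SUP[OF assms(1,2,6,4,5)] c by (simp add: ereal_divide_le_pos)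
  qed
  then show ?thesis using c by (simp add: ereal_divide_le_pos)
qed

end
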